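(* Let $X$ be a non-negative random variable with $a:=\mathbb{E}X\in(0,\infty)$, and let $c\in(0,\infty)$. Assume that $X$ admits a $c$-bounded size bias coupling. Then for every $x\ge a$, $$\mathbb{P}(X\ge x)\ \le\ \exp\left(-\frac{(x-a)^2}{c(a+x)}\right),$$ and for every $x$ with $0\le x\le a$, $$\mathbb{P}(X\le x)\ \le\ \exp\left(-\frac{(x-a)^2}{2ca}\right).$$
   Context: For a non-negative random variable $X$ with $0<\mathbb{E}X<\infty$, a random variable $Y$ is said to have the size biased distribution of $X$, written $Y=^d X^*$, if $\mathbb{P}(Y\in dx)/\mathbb{P}(X\in dx)=x/\mathbb{E}X$ (Radon–Nikodym derivative), i.e. $\mathbb{E}\,g(Y)=\mathbb{E}(Xg(X))/\mathbb{E}X$ for all bounded measurable $g$. A coupling of $X$ and $Y$ is a realization of random variables with the distributions of $X$ and $Y$ on a common probability space. We say that $X$ admits a $c$-bounded size bias coupling if there is a coupling of $X$ with $Y=^dX^*$ in which $Y\le X+c$ almost surely. *)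

theory Defs
  imports "HOL-Probability.Probability"
begin

text \<open>
  \<open>Y\<close> (on \<open>N\<close>) has the size biased distribution of \<open>X\<close> (on \<open>M\<close>): the law of \<open>Y\<close> has
  Radon--Nikodym derivative \<open>x / E X\<close> with respect to the law of \<open>X\<close>.  The notion is meant for an
  (almost surely) non-negative \<open>X\<close> with finite positive mean; for such \<open>X\<close> the truncation of
  negative values in \<open>ennreal\<close> only affects a null set of the law of \<open>X\<close>.
\<close>

definition size_biased ::
  "'a measure \<Rightarrow> ('a \<Rightarrow> real) \<Rightarrow> 'b measure \<Rightarrow> ('b \<Rightarrow> real) \<Rightarrow> bool" where
  "size_biased M X N Y \<longleftrightarrow>
     distributed N (distr M borel X) Y (\<lambda>x. ennreal (x / prob_space.expectation M X))"

text \<open>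
  \<open>X'\<close> and \<open>Y\<close> realise the law of \<open>X\<close> and its size biased law on the common probability space
  \<open>N\<close>, which need not be the space \<open>M\<close> on which \<open>X\<close> itself lives.
\<close>

definition bounded_size_bias_coupling ::
  "real \<Rightarrow> 'a measure \<Rightarrow> ('a \<Rightarrow> real) \<Rightarrow> 'b measure \<Rightarrow> ('b \<Rightarrow> real) \<Rightarrow> ('b \<Rightarrow> real) \<Rightarrow> bool" where
  "bounded_size_bias_coupling c M X N X' Y \<longleftrightarrow>
     prob_space N \<and> X' \<in> borel_measurable N \<and> Y \<in> borel_measurable N \<and>
     distr N borel X' = distr M borel X \<and> size_biased M X N Y \<and>
     (AE \<omega> in N. Y \<omega> \<le> X' \<omega> + c)"

lemma size_biased_expectation:
  fixes g :: "real \<Rightarrow> real"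
  assumes "size_biased M X N Y" "X \<in> borel_measurable M" "AE \<omega> in M. 0 \<le> X \<omega>"
    and "0 < prob_space.expectation M X" and g: "g \<in> borel_measurable borel"
  shows "prob_space.expectation N (\<lambda>\<omega>. g (Y \<omega>)) =
         prob_space.expectation M (\<lambda>\<omega>. X \<omega> * g (X \<omega>)) / prob_space.expectation M X"
proof -
  let ?m = "integral\<^sup>L M X"
  have [measurable]: "X \<in> borel_measurable M" "g \<in> borel_measurable borel" by fact+
  have D: "distributed N (distr M borel X) Y (\<lambda>x. ennreal (x / ?m))"
    using assms(1) by (simp add: size_biased_def)
  have [measurable]: "Y \<in> borel_measurable N"
    using distributed_measurable[OF D] by simp
  have nn: "AE x in distr M borel X. 0 \<le> x / ?m"
    using assms(3,4) by (subst AE_distr_iff) (auto elim: eventually_mono)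
  have "integral\<^sup>L N (\<lambda>\<omega>. g (Y \<omega>)) = integral\<^sup>L (distr N (distr M borel X) Y) g"
    by (subst integral_distr) auto
  also have "\<dots> = integral\<^sup>L (density (distr M borel X) (\<lambda>x. ennreal (x / ?m))) g"
    using D by (simp add: distributed_def)
  also have "\<dots> = (\<integral>x. (x / ?m) * g x \<partial>distr M borel X)"
    using nn by (subst integral_density) auto
  also have "\<dots> = (\<integral>\<omega>. (X \<omega> * g (X \<omega>)) / ?m \<partial>M)"
    by (subst integral_distr) auto
  finally show ?thesis by simp
qed

end

theory Submission
  imports Defs
begin

text \<open>
  The proof is Chernoff's method. Size biasing turns the derivative of the moment generating
  function \<open>m(t) = E exp (t X)\<close> into an expectation over the coupled variable:
  \<open>m'(t) = E (X exp (t X)) = a E exp (t Y)\<close>. Since \<open>Y \<le> X + c\<close>, this is at most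
  \<open>a exp (c t) m(t)\<close> when \<open>t \<ge> 0\<close>, and at least that when \<open>t \<le> 0\<close>. Integrating the differential
  inequality away from \<open>m(0) = 1\<close> gives, for both signs of \<open>t\<close>,
  \<open>m(t) \<le> exp (a (exp (c t) - 1) / c)\<close>: the right-hand side is the moment
  generating function of \<open>c\<close> times a Poisson variable of mean \<open>a / c\<close>. Markov's inequality for
  \<open>exp (t X)\<close> finishes the proof, with \<open>t = ln (x / a) / c\<close> for the upper tail and
  \<open>t = - (a - x) / (c a)\<close> for the lower one. The exponents take their final form through
  \<open>ln (x / a) \<ge> 2 (x - a) / (x + a)\<close> and \<open>exp (- s) \<le> 1 - s + s\<^sup>2 / 2\<close> respectively.

  It is not known beforehand that \<open>m(t)\<close> is finite for \<open>t > 0\<close>. Therefore the upper tail works with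
  \<open>min X x\<close> instead of \<open>X\<close>: this variable is bounded, it reaches the level \<open>x\<close> exactly when \<open>X\<close>
  does, and truncation preserves both \<open>Y \<le> X + c\<close> and the direction of the differential
  inequality. The lower tail is treated as the upper tail of \<open>- X\<close>, so that one moment generating
  function lemma (\<open>mgf_le_exp_of_log_derivative_le\<close>) and one comparison lemma
  (\<open>size_bias_coupling_compare\<close>) serve both.
\<close>

section \<open>Moment generating functions and differential inequalities\<close>

lemma gronwall_le_exp:
  fixes m m' R R' :: "real \<Rightarrow> real"
  assumes "0 \<le> T"
    and m: "\<And>t. t \<in> {0..T} \<Longrightarrow> (m has_real_derivative m' t) (at t within {0..T})"
    and R: "\<And>t. t \<in> {0..T} \<Longrightarrow> (R has_real_derivative R' t) (at t within {0..T})"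
    and le: "\<And>t. 0 < t \<Longrightarrow> t < T \<Longrightarrow> m' t \<le> R' t * m t"
  shows "m T \<le> m 0 * exp (R T - R 0)"
proof -
  let ?\<phi> = "\<lambda>t. m t * exp (- R t)"
  have \<phi>: "(?\<phi> has_real_derivative (m' t - R' t * m t) * exp (- R t)) (at t within {0..T})"
    if "t \<in> {0..T}" for t
    by (rule derivative_eq_intros m[OF that] R[OF that] refl)+ (simp add: algebra_simps)
  have "?\<phi> T \<le> ?\<phi> 0"
  proof (rule DERIV_nonpos_imp_decreasing_open[OF \<open>0 \<le> T\<close>])
    fix t assume t: "0 < t" "t < T"
    have "at t within {0..T} = at t"
      using t by (intro at_within_interior) auto
    then have "(?\<phi> has_real_derivative (m' t - R' t * m t) * exp (- R t)) (at t)"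
      using \<phi>[of t] t by simp
    moreover have "(m' t - R' t * m t) * exp (- R t) \<le> 0"
      using le[OF t] by (simp add: mult_le_0_iff)
    ultimately show "\<exists>y. (?\<phi> has_real_derivative y) (at t) \<and> y \<le> 0"
      by blast
  next
    show "continuous_on {0..T} ?\<phi>"
      by (rule DERIV_continuous_on[OF \<phi>])
  qed
  then have "?\<phi> T * exp (R T) \<le> ?\<phi> 0 * exp (R T)"
    by (rule mult_right_mono) simp
  then show ?thesis
    by (simp add: mult.assoc flip: exp_add)
qed

text \<open>
  By the mean value theorem the difference quotients of \<open>t \<mapsto> exp (t Z)\<close> are bounded by
  \<open>B |Z|\<close>, so dominated convergence allows differentiation under the expectation.
\<close>
lemma mgf_has_derivative_within:
  fixes Z :: "'a \<Rightarrow> real"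
  assumes Z: "integrable M Z"
    and S: "convex S"
    and B: "\<And>u \<omega>. u \<in> S \<Longrightarrow> exp (u * Z \<omega>) \<le> B"
    and t: "t \<in> S"
    and int: "\<And>u. u \<in> S \<Longrightarrow> integrable M (\<lambda>\<omega>. exp (u * Z \<omega>))"
  shows "((\<lambda>t. \<integral>\<omega>. exp (t * Z \<omega>) \<partial>M) has_real_derivative (\<integral>\<omega>. Z \<omega> * exp (t * Z \<omega>) \<partial>M))
           (at t within S)"
  unfolding has_field_derivative_iff tendsto_at_iff_sequentially
proof (intro allI impI)
  fix u :: "nat \<Rightarrow> real" assume u: "\<forall>i. u i \<in> S - {t}" "u \<longlonglongrightarrow> t"
  have [measurable]: "Z \<in> borel_measurable M"
    using Z by auto
  let ?q = "\<lambda>i \<omega>. (exp (u i * Z \<omega>) - exp (t * Z \<omega>)) / (u i - t)"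
  have "(\<lambda>i. \<integral>\<omega>. ?q i \<omega> \<partial>M) \<longlonglongrightarrow> (\<integral>\<omega>. Z \<omega> * exp (t * Z \<omega>) \<partial>M)"
  proof (rule integral_dominated_convergence[where w="\<lambda>\<omega>. B * \<bar>Z \<omega>\<bar>"])
    show "AE \<omega> in M. (\<lambda>i. ?q i \<omega>) \<longlonglongrightarrow> Z \<omega> * exp (t * Z \<omega>)"
    proof (rule AE_I2)
      fix \<omega>
      have "((\<lambda>t. exp (t * Z \<omega>)) has_real_derivative Z \<omega> * exp (t * Z \<omega>)) (at t within S)"
        by (auto intro!: derivative_eq_intros)
      then show "(\<lambda>i. ?q i \<omega>) \<longlonglongrightarrow> Z \<omega> * exp (t * Z \<omega>)"
        using u unfolding has_field_derivative_iff tendsto_at_iff_sequentially comp_def by blast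
    qed
    show "AE \<omega> in M. norm (?q i \<omega>) \<le> B * \<bar>Z \<omega>\<bar>" for i
    proof (rule AE_I2)
      fix \<omega>
      have "norm (exp (u i * Z \<omega>) - exp (t * Z \<omega>)) \<le> (B * \<bar>Z \<omega>\<bar>) * norm (u i - t)"
      proof (rule field_differentiable_bound[OF S])
        show "((\<lambda>t. exp (t * Z \<omega>)) has_field_derivative Z \<omega> * exp (s * Z \<omega>)) (at s within S)" for s
          by (auto intro!: derivative_eq_intros)
        show "norm (Z \<omega> * exp (s * Z \<omega>)) \<le> B * \<bar>Z \<omega>\<bar>" if "s \<in> S" for s
          using mult_right_mono[OF B[OF that], of "\<bar>Z \<omega>\<bar>" \<omega>] by (simp add: abs_mult mult.commute)
      qed (use u t in auto)
      moreover have "u i - t \<noteq> 0"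
        using u by auto
      ultimately show "norm (?q i \<omega>) \<le> B * \<bar>Z \<omega>\<bar>"
        by (simp add: field_simps abs_divide)
    qed
  qed (use Z in auto)
  moreover have "(\<integral>\<omega>. ?q i \<omega> \<partial>M)
      = ((\<integral>\<omega>. exp (u i * Z \<omega>) \<partial>M) - (\<integral>\<omega>. exp (t * Z \<omega>) \<partial>M)) / (u i - t)" for i
    using int[of "u i"] int[of t] u t by simp
  ultimately show "((\<lambda>y. ((\<integral>\<omega>. exp (y * Z \<omega>) \<partial>M) - (\<integral>\<omega>. exp (t * Z \<omega>) \<partial>M)) / (y - t)) \<circ> u)
      \<longlonglongrightarrow> (\<integral>\<omega>. Z \<omega> * exp (t * Z \<omega>) \<partial>M)"
    by (simp only: comp_def)
qed

context prob_space
begin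

text \<open>
  The hypothesis bounds the logarithmic derivative of the moment generating function by \<open>R'\<close>; the
  upper bound \<open>K\<close> on \<open>Z\<close> is what makes that function finite and differentiable on \<open>{0..T}\<close>.
\<close>
lemma mgf_le_exp_of_log_derivative_le:
  fixes Z :: "'a \<Rightarrow> real"
  assumes Z: "integrable M Z" and K: "\<And>\<omega>. Z \<omega> \<le> K"
    and "0 \<le> T"
    and R: "\<And>t. (R has_real_derivative R' t) (at t)"
    and le: "\<And>t. 0 \<le> t \<Longrightarrow>
      expectation (\<lambda>\<omega>. Z \<omega> * exp (t * Z \<omega>)) \<le> R' t * expectation (\<lambda>\<omega>. exp (t * Z \<omega>))"
  shows "integrable M (\<lambda>\<omega>. exp (T * Z \<omega>))"
    and "expectation (\<lambda>\<omega>. exp (T * Z \<omega>)) \<le> exp (R T - R 0)"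
proof -
  have [measurable]: "Z \<in> borel_measurable M"
    using Z by auto
  have B: "exp (t * Z \<omega>) \<le> exp (T * \<bar>K\<bar>)" if "t \<in> {0..T}" for t \<omega>
  proof -
    have "t * Z \<omega> \<le> t * \<bar>K\<bar>"
      using that K[of \<omega>] by (intro mult_left_mono) auto
    also have "\<dots> \<le> T * \<bar>K\<bar>"
      using that by (intro mult_right_mono) auto
    finally show ?thesis
      by simp
  qed
  have int: "integrable M (\<lambda>\<omega>. exp (t * Z \<omega>))" if "t \<in> {0..T}" for t
    by (rule integrable_const_bound[where B="exp (T * \<bar>K\<bar>)"]) (use B[OF that] in auto)
  then show "integrable M (\<lambda>\<omega>. exp (T * Z \<omega>))"
    using \<open>0 \<le> T\<close> by simp
  have "expectation (\<lambda>\<omega>. exp (T * Z \<omega>)) \<le> expectation (\<lambda>\<omega>. exp (0 * Z \<omega>)) * exp (R T - R 0)"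
  proof (rule gronwall_le_exp[OF \<open>0 \<le> T\<close>])
    show "((\<lambda>t. expectation (\<lambda>\<omega>. exp (t * Z \<omega>))) has_real_derivative
        expectation (\<lambda>\<omega>. Z \<omega> * exp (t * Z \<omega>))) (at t within {0..T})" if "t \<in> {0..T}" for t
      by (rule mgf_has_derivative_within[OF Z _ B that int]) auto
    show "(R has_real_derivative R' t) (at t within {0..T})" for t
      using R by (rule has_field_derivative_at_within)
  qed (rule le, simp)
  then show "expectation (\<lambda>\<omega>. exp (T * Z \<omega>)) \<le> exp (R T - R 0)"
    by (simp add: prob_space)
qed

end

section \<open>Comparison through the coupling\<close>

text \<open>
  The left-hand side is \<open>E X\<close> times \<open>E g(Y)\<close>, and \<open>g(Y) \<le> h(X')\<close> almost surely; this is the only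
  place where the coupling enters.
\<close>
lemma size_bias_coupling_compare:
  fixes g h :: "real \<Rightarrow> real"
  assumes "bounded_size_bias_coupling c M X N X' Y"
    and [measurable]: "X \<in> borel_measurable M"
    and "AE \<omega> in M. 0 \<le> X \<omega>" and pos: "0 < prob_space.expectation M X"
    and [measurable]: "g \<in> borel_measurable borel" "h \<in> borel_measurable borel"
    and bdd: "\<And>x. \<bar>g x\<bar> \<le> B" "\<And>x. \<bar>h x\<bar> \<le> B"
    and gh: "\<And>x y. y \<le> x + c \<Longrightarrow> g y \<le> h x"
  shows "prob_space.expectation M (\<lambda>\<omega>. X \<omega> * g (X \<omega>))
           \<le> prob_space.expectation M X * prob_space.expectation M (\<lambda>\<omega>. h (X \<omega>))"
proof -
  interpret N: prob_space N
    using assms(1) by (simp add: bounded_size_bias_coupling_def)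
  have [measurable]: "X' \<in> borel_measurable N" "Y \<in> borel_measurable N"
    and law: "distr N borel X' = distr M borel X"
    and sb: "size_biased M X N Y" and le: "AE \<omega> in N. Y \<omega> \<le> X' \<omega> + c"
    using assms(1) by (auto simp: bounded_size_bias_coupling_def)
  have "prob_space.expectation M (\<lambda>\<omega>. X \<omega> * g (X \<omega>)) / prob_space.expectation M X
      = N.expectation (\<lambda>\<omega>. g (Y \<omega>))"
    using size_biased_expectation[OF sb assms(2-4)] by simp
  also have "\<dots> \<le> N.expectation (\<lambda>\<omega>. h (X' \<omega>))"
    using le bdd gh
    by (intro integral_mono_AE N.integrable_const_bound[where B=B]) (auto elim: eventually_mono)
  also have "\<dots> = integral\<^sup>L (distr N borel X') h"
    by (simp add: integral_distr)
  also have "\<dots> = prob_space.expectation M (\<lambda>\<omega>. h (X \<omega>))"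
    by (simp add: law integral_distr)
  finally show ?thesis
    using pos by (simp add: field_simps)
qed

section \<open>Tail bounds\<close>

lemma bennett_exponent_le:
  fixes a x :: real
  assumes "0 < a" "a < x"
  shows "x - a - x * ln (x / a) \<le> - ((x - a)\<^sup>2 / (a + x))"
proof -
  have "x * (2 * (x - a) / (a + x)) \<le> x * ln (x / a)"
    using ln_inverse_approx_ge[of a x] assms by (intro mult_left_mono) (auto simp: ln_div)
  moreover have "x - a - x * (2 * (x - a) / (a + x)) = - ((x - a)\<^sup>2 / (a + x))"
    using assms by (simp add: field_simps power2_eq_square)
  ultimately show ?thesis
    by linarith
qed

lemma exp_minus_le_quadratic:
  fixes s :: real
  assumes "0 \<le> s"
  shows "exp (- s) \<le> 1 - s + s\<^sup>2 / 2"
proof -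
  let ?f = "\<lambda>s. 1 - s + s\<^sup>2 / 2 - exp (- s) :: real"
  have "?f 0 \<le> ?f s"
  proof (rule DERIV_nonneg_imp_nondecreasing[OF assms])
    fix u :: real
    have "(?f has_real_derivative u - 1 + exp (- u)) (at u)"
      by (auto intro!: derivative_eq_intros)
    moreover have "0 \<le> u - 1 + exp (- u)"
      using exp_ge_add_one_self[of "- u"] by simp
    ultimately show "\<exists>y. (?f has_real_derivative y) (at u) \<and> 0 \<le> y"
      by blast
  qed
  then show ?thesis
    by simp
qed

locale size_bias_bounded = prob_space M
  for M :: "'a measure" and X :: "'a \<Rightarrow> real" and N :: "'b measure" and X' Y and a c :: real +
  assumes X: "integrable M X" and X_nonneg: "AE \<omega> in M. 0 \<le> X \<omega>"
    and mean: "expectation X = a" and a_pos: "0 < a" and c_pos: "0 < c"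
    and coupling: "bounded_size_bias_coupling c M X N X' Y"
begin

lemma X_measurable [measurable]: "X \<in> borel_measurable M"
  using X by auto

lemmas compare = size_bias_coupling_compare[OF coupling X_measurable X_nonneg,
    unfolded mean, OF a_pos]

lemma upper_tail:
  assumes "a < x"
  shows "prob {\<omega> \<in> space M. X \<omega> \<ge> x} \<le> exp (- ((x - a)\<^sup>2 / (c * (a + x))))"
proof -
  define Z where "Z = (\<lambda>\<omega>. min (X \<omega>) x)"
  define R where "R t = a * exp (c * t) / c" for t
  \<comment> \<open>the minimiser of the Chernoff exponent \<open>R T - R 0 - T * x\<close>\<close>
  define T where "T = ln (x / a) / c"
  have T: "0 < T"
    using assms a_pos c_pos by (simp add: T_def)
  have expT: "exp (c * T) = x / a"
    using assms a_pos c_pos by (simp add: T_def)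
  have Z_le: "Z \<omega> \<le> x" for \<omega>
    by (simp add: Z_def)
  have Z: "integrable M Z"
    using X by (simp add: Z_def)
  have [measurable]: "Z \<in> borel_measurable M"
    using Z by auto
  have R: "(R has_real_derivative a * exp (c * t)) (at t)" for t
    unfolding R_def using c_pos by (auto intro!: derivative_eq_intros)
  have "expectation (\<lambda>\<omega>. Z \<omega> * exp (t * Z \<omega>)) \<le> a * exp (c * t) * expectation (\<lambda>\<omega>. exp (t * Z \<omega>))"
    if t: "0 \<le> t" for t
  proof -
    have b: "exp (t * min y x) \<le> exp (t * x)" for y
      using t by (simp add: mult_left_mono)
    have "expectation (\<lambda>\<omega>. Z \<omega> * exp (t * Z \<omega>)) \<le> expectation (\<lambda>\<omega>. X \<omega> * exp (t * Z \<omega>))"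
    proof (rule integral_mono)
      have "integrable M (\<lambda>\<omega>. W \<omega> * exp (t * Z \<omega>))" if W: "integrable M W" for W :: "'a \<Rightarrow> real"
      proof (rule Bochner_Integration.integrable_bound[where f="\<lambda>\<omega>. exp (t * x) * W \<omega>"])
        show "integrable M (\<lambda>\<omega>. exp (t * x) * W \<omega>)"
          using W by simp
        have "W \<in> borel_measurable M"
          using W by auto
        then show "(\<lambda>\<omega>. W \<omega> * exp (t * Z \<omega>)) \<in> borel_measurable M"
          by measurable
        show "AE \<omega> in M. norm (W \<omega> * exp (t * Z \<omega>)) \<le> norm (exp (t * x) * W \<omega>)"
          by (rule AE_I2) (use mult_left_mono[OF b] in \<open>simp add: abs_mult Z_def mult.commute\<close>)
      qed
      then show "integrable M (\<lambda>\<omega>. Z \<omega> * exp (t * Z \<omega>))" "integrable M (\<lambda>\<omega>. X \<omega> * exp (t * Z \<omega>))"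
        using Z X by auto
    qed (simp add: Z_def)
    also have "\<dots> \<le> a * expectation (\<lambda>\<omega>. exp (c * t) * exp (t * Z \<omega>))"
      unfolding Z_def
    proof (rule compare[where B="exp (c * t) * exp (t * x)"])
      fix z y :: real
      have ct: "1 \<le> exp (c * t)"
        using t c_pos by simp
      show "\<bar>exp (t * min y x)\<bar> \<le> exp (c * t) * exp (t * x)"
        using mult_mono[OF ct b[of y]] by simp
      show "\<bar>exp (c * t) * exp (t * min y x)\<bar> \<le> exp (c * t) * exp (t * x)"
        using b[of y] by simp
      assume "y \<le> z + c"
      then have "t * min y x \<le> t * (c + min z x)"
        using c_pos t by (intro mult_left_mono) auto
      then show "exp (t * min y x) \<le> exp (c * t) * exp (t * min z x)"
        by (simp add: algebra_simps flip: exp_add)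
    qed measurable
    finally show ?thesis
      by (simp add: mult.assoc)
  qed
  note mgf = mgf_le_exp_of_log_derivative_le[OF Z Z_le less_imp_le[OF T] R this]
  have "{\<omega> \<in> space M. X \<omega> \<ge> x} = {\<omega> \<in> space M. Z \<omega> \<ge> x}"
    by (auto simp: Z_def)
  also have "prob \<dots> \<le> exp (- T * x) * (\<integral>\<omega>\<in>space M. exp (T * Z \<omega>) \<partial>M)"
    using mgf(1)
    by (intro Chernoff_ineq_ge[OF T, unfolded set_integrable_def] integrable_mult_indicator) auto
  also have "\<dots> \<le> exp (- T * x) * exp (R T - R 0)"
    using mgf by (intro mult_left_mono) (auto simp: set_integral_space)
  also have "\<dots> = exp ((x - a - x * ln (x / a)) / c)"
    using a_pos c_pos by (simp add: R_def expT flip: exp_add) (simp add: T_def field_simps)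
  also have "\<dots> \<le> exp (- ((x - a)\<^sup>2 / (a + x)) / c)"
    using bennett_exponent_le[OF a_pos assms] c_pos
    by (intro exp_le_cancel_iff[THEN iffD2] divide_right_mono) auto
  finally show ?thesis
    by (simp add: mult.commute)
qed

text \<open>
  Replacing \<open>X\<close> by \<open>max X 0\<close> changes nothing almost surely, and it makes \<open>exp (- t * max y 0)\<close>
  bounded in \<open>y\<close>, as the comparison lemma requires.
\<close>
lemma lower_tail:
  assumes "x < a"
  shows "prob {\<omega> \<in> space M. X \<omega> \<le> x} \<le> exp (- ((x - a)\<^sup>2 / (2 * c * a)))"
proof -
  define Z where "Z = (\<lambda>\<omega>. - max (X \<omega>) 0)"
  define R where "R t = a * exp (- (c * t)) / c" for t
  \<comment> \<open>the minimiser of the Chernoff exponent once \<open>R\<close> is replaced by its quadratic upper bound\<close>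
  define T where "T = (a - x) / (c * a)"
  have T: "0 < T"
    using assms a_pos c_pos by (simp add: T_def)
  have Z_le: "Z \<omega> \<le> 0" for \<omega>
    by (simp add: Z_def)
  have Z: "integrable M Z"
    using X by (simp add: Z_def)
  have AE_Z: "AE \<omega> in M. Z \<omega> = - X \<omega>"
    using X_nonneg by (auto simp: Z_def elim: eventually_mono)
  have [measurable]: "Z \<in> borel_measurable M"
    using Z by auto
  have R: "(R has_real_derivative - a * exp (- (c * t))) (at t)" for t
    unfolding R_def using c_pos by (auto intro!: derivative_eq_intros)
  have "expectation (\<lambda>\<omega>. Z \<omega> * exp (t * Z \<omega>))
      \<le> - a * exp (- (c * t)) * expectation (\<lambda>\<omega>. exp (t * Z \<omega>))"
    if t: "0 \<le> t" for t
  proof -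
    have "expectation (\<lambda>\<omega>. Z \<omega> * exp (t * Z \<omega>)) = expectation (\<lambda>\<omega>. X \<omega> * - exp (t * Z \<omega>))"
      using AE_Z by (intro integral_cong_AE) (auto elim: eventually_mono)
    also have "\<dots> \<le> a * expectation (\<lambda>\<omega>. - (exp (- (c * t)) * exp (t * Z \<omega>)))"
      unfolding Z_def
    proof (rule compare[where B=1])
      fix z y :: real
      have b: "exp (t * - max y 0) \<le> 1"
        using t by (simp add: mult_nonneg_nonneg)
      then show "\<bar>- exp (t * - max y 0)\<bar> \<le> 1"
        by simp
      have "exp (- (c * t)) \<le> 1"
        using t c_pos by simp
      then show "\<bar>- (exp (- (c * t)) * exp (t * - max y 0))\<bar> \<le> 1"
        using mult_mono[OF _ b, of "exp (- (c * t))" 1] by simp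
      assume "y \<le> z + c"
      then have "t * max y 0 \<le> t * (c + max z 0)"
        using c_pos t by (intro mult_left_mono) auto
      then show "- exp (t * - max y 0) \<le> - (exp (- (c * t)) * exp (t * - max z 0))"
        by (simp add: algebra_simps flip: exp_add)
    qed measurable
    finally show ?thesis
      by (simp add: mult.assoc)
  qed
  note mgf = mgf_le_exp_of_log_derivative_le[OF Z Z_le less_imp_le[OF T] R this]
  have "prob {\<omega> \<in> space M. X \<omega> \<le> x} = prob {\<omega> \<in> space M. Z \<omega> \<ge> - x}"
    using AE_Z by (intro finite_measure_eq_AE) (auto elim: eventually_mono)
  also have "\<dots> \<le> exp (- T * - x) * (\<integral>\<omega>\<in>space M. exp (T * Z \<omega>) \<partial>M)"
    using mgf(1)
    by (intro Chernoff_ineq_ge[OF T, unfolded set_integrable_def] integrable_mult_indicator) auto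
  also have "\<dots> \<le> exp (T * x) * exp (R T - R 0)"
    using mgf by (auto simp: set_integral_space)
  also have "\<dots> = exp (T * x + a * (exp (- (c * T)) - 1) / c)"
    by (simp add: R_def diff_divide_distrib right_diff_distrib flip: exp_add)
  also have "\<dots> \<le> exp (T * x + a * (- (c * T) + (c * T)\<^sup>2 / 2) / c)"
    using exp_minus_le_quadratic[of "c * T"] T a_pos c_pos
    by (intro exp_le_cancel_iff[THEN iffD2] add_left_mono divide_right_mono mult_left_mono) auto
  also have "T * x + a * (- (c * T) + (c * T)\<^sup>2 / 2) / c = - ((x - a)\<^sup>2 / (2 * c * a))"
    using a_pos c_pos by (simp add: T_def field_simps power2_eq_square)
  finally show ?thesis .
qed

end

theorem corollary1p1:
  fixes M :: "'a measure" and X :: "'a \<Rightarrow> real" and a c :: real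
  assumes "prob_space M"
    and "X \<in> borel_measurable M"
    and "AE \<omega> in M. 0 \<le> X \<omega>"
    and "integrable M X"
    and "a = prob_space.expectation M X"
    and "0 < a"
    and "0 < c"
    and "\<exists>(N :: 'b measure) X' Y. bounded_size_bias_coupling c M X N X' Y"
  shows "(\<forall>x\<ge>a. \<P>(\<omega> in M. X \<omega> \<ge> x) \<le> exp (- ((x - a)\<^sup>2 / (c * (a + x))))) \<and>
         (\<forall>x. 0 \<le> x \<and> x \<le> a \<longrightarrow> \<P>(\<omega> in M. X \<omega> \<le> x) \<le> exp (- ((x - a)\<^sup>2 / (2 * c * a))))"
proof -
  from assms(8) obtain N :: "'b measure" and X' Y
    where "bounded_size_bias_coupling c M X N X' Y"
    by blast
  then interpret size_bias_bounded M X N X' Y a c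
    using assms by (simp add: size_bias_bounded_def size_bias_bounded_axioms_def)
  \<comment> \<open>at \<open>x = a\<close> both bounds equal \<open>1\<close>\<close>
  show ?thesis
  proof (intro conjI allI impI)
    show "prob {\<omega> \<in> space M. x \<le> X \<omega>} \<le> exp (- ((x - a)\<^sup>2 / (c * (a + x))))" if "a \<le> x" for x
      using that upper_tail[of x] by (cases "x = a") auto
    show "prob {\<omega> \<in> space M. X \<omega> \<le> x} \<le> exp (- ((x - a)\<^sup>2 / (2 * c * a)))"
      if "0 \<le> x \<and> x \<le> a" for x
      using that lower_tail[of x] by (cases "x = a") auto
  qed
qed

end
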